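(* Let $A$ be a finite set with $\lvert A\rvert\ge2$, and let $\mathcal{C}_1\subseteq\mathcal{C}_2$ be equational classes on $A$ that are idempotent under class composition. Then the interval $[\mathcal{C}_1,\mathcal{C}_2]=\{\mathcal{K}\in{\bf E}_A:\mathcal{C}_1\subseteq\mathcal{K}\subseteq\mathcal{C}_2\}$ contains uncountably many ($2^{\aleph_0}$) equational classes if and only if $\mathcal{C}_2\setminus\mathcal{C}_1$ contains an infinite antichain of operations with respect to $\preceq_{\bf V}$.
   Context: An operation on $A$ is a map $A^n\to A$, $n\ge1$. Class composition: $\mathcal{I}\mathcal{J}=\{f(g_1,\dots,g_n): f\ n\text{-ary in }\mathcal{I},\ g_1,\dots,g_n\ m\text{-ary in }\mathcal{J}\}$, where $f(g_1,\dots,g_n)({\bf a})=f(g_1({\bf a}),\dots,g_n({\bf a}))$. $\mathcal{P}_A$ is the class of projections; ${\bf E}_A$ is the set of equational classes, i.e. classes $\mathcal{K}$ with $\mathcal{K}\mathcal{P}_A=\mathcal{K}$. A class $\mathcal{C}$ is idempotent if $\mathcal{C}\mathcal{C}=\mathcal{C}$. For an $m$-ary $g$ and $n$-ary $f$, $g\preceq_{\bf V}f$ means $g=f(p_1,\dots,p_n)$ for some $m$-ary projections $p_1,\dots,p_n$; this is a preorder. An antichain is a set of operations any two of which are incomparable ($f\not\preceq_{\bf V}g$ and $g\not\preceq_{\bf V}f$). *)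

theory Defs
  imports Complex_Main "HOL-Library.Cardinality" "HOL-Library.FuncSet" "HOL-Library.Countable_Set" "HOL-Library.Equipollence"
begin

text \<open>
  The base set is the universe of the type variable. An \<open>n\<close>-tuple is a list of length \<open>n\<close>.
  An operation carries its arity \<open>n \<ge> 1\<close>; its function part is \<open>undefined\<close> on lists
  of any other length, so that equality of operations is equality of arities and of values on
  all \<open>n\<close>-tuples.
\<close>

typedef 'a operation =
  "{(n, f). 1 \<le> n \<and> f \<in> extensional {xs. length xs = n}} :: (nat \<times> ('a list \<Rightarrow> 'a)) set"
  morphisms rep_operation abs_operation
proof
  show "(1, restrict hd {xs. length xs = 1})
    \<in> {(n, f). 1 \<le> n \<and> f \<in> extensional {xs. length xs = n}}"
    by simp
qed

definition arity :: "'a operation \<Rightarrow> nat" where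
  "arity f = fst (rep_operation f)"

definition app :: "'a operation \<Rightarrow> 'a list \<Rightarrow> 'a" where
  "app f = snd (rep_operation f)"

text \<open>Only meaningful for \<open>n \<ge> 1\<close>.\<close>

definition mk_operation :: "nat \<Rightarrow> ('a list \<Rightarrow> 'a) \<Rightarrow> 'a operation" where
  "mk_operation n F = abs_operation (n, restrict F {xs. length xs = n})"

lemma arity_ge_1: "1 \<le> arity f"
  using rep_operation[of f] by (auto simp: arity_def)

lemma rep_mk_operation:
  "1 \<le> n \<Longrightarrow> rep_operation (mk_operation n F) = (n, restrict F {xs. length xs = n})"
  by (simp add: mk_operation_def abs_operation_inverse)

lemma arity_mk_operation: "1 \<le> n \<Longrightarrow> arity (mk_operation n F) = n"
  by (simp add: arity_def rep_mk_operation)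

lemma app_mk_operation: "1 \<le> n \<Longrightarrow> length xs = n \<Longrightarrow> app (mk_operation n F) xs = F xs"
  by (simp add: app_def rep_mk_operation)

lemma operation_eqI:
  assumes "arity f = arity g" and "\<And>xs. length xs = arity f \<Longrightarrow> app f xs = app g xs"
  shows "f = g"
proof -
  have "snd (rep_operation f) \<in> extensional {xs. length xs = arity f}"
    and "snd (rep_operation g) \<in> extensional {xs. length xs = arity f}"
    using rep_operation[of f] rep_operation[of g] assms(1) by (auto simp: arity_def)
  then have "snd (rep_operation f) = snd (rep_operation g)"
    using assms(2) by (auto intro: extensionalityI simp: app_def)
  with assms(1) show ?thesis
    by (simp add: arity_def prod_eq_iff flip: rep_operation_inject)
qed

text \<open>
  The \<open>m\<close>-ary operation \<open>f(g\<^sub>1, \<dots>, g\<^sub>n)\<close>, meaningful when \<open>gs\<close> is a list of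
  \<open>arity f\<close> many \<open>m\<close>-ary operations.
\<close>

definition superpose :: "nat \<Rightarrow> 'a operation \<Rightarrow> 'a operation list \<Rightarrow> 'a operation" where
  "superpose m f gs = mk_operation m (\<lambda>xs. app f (map (\<lambda>g. app g xs) gs))"

definition class_comp :: "'a operation set \<Rightarrow> 'a operation set \<Rightarrow> 'a operation set" where
  "class_comp I J = {superpose m f gs | m f gs.
     1 \<le> m \<and> f \<in> I \<and> length gs = arity f \<and> (\<forall>g\<in>set gs. g \<in> J \<and> arity g = m)}"

definition projection :: "nat \<Rightarrow> nat \<Rightarrow> 'a operation" where
  "projection m i = mk_operation m (\<lambda>xs. xs ! i)"

definition projections :: "'a operation set" where
  "projections = {projection m i | m i. i < m}"

definition equational_classes :: "'a operation set set" where
  "equational_classes = {K. class_comp K projections = K}"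

definition idempotent_class :: "'a operation set \<Rightarrow> bool" where
  "idempotent_class C \<longleftrightarrow> class_comp C C = C"

definition minor_le :: "'a operation \<Rightarrow> 'a operation \<Rightarrow> bool"  (infix "\<preceq>\<^sub>V" 50) where
  "g \<preceq>\<^sub>V f \<longleftrightarrow> (\<exists>ps. length ps = arity f \<and>
     (\<forall>p\<in>set ps. p \<in> projections \<and> arity p = arity g) \<and> g = superpose (arity g) f ps)"

definition antichain :: "'a operation set \<Rightarrow> bool" where
  "antichain S \<longleftrightarrow> pairwise (\<lambda>f g. \<not> f \<preceq>\<^sub>V g \<and> \<not> g \<preceq>\<^sub>V f) S"

definition class_interval :: "'a operation set \<Rightarrow> 'a operation set \<Rightarrow> 'a operation set set" where
  "class_interval C1 C2 = {K \<in> equational_classes. C1 \<subseteq> K \<and> K \<subseteq> C2}"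

end

theory Submission
  imports Defs
begin

text \<open>
  Equational classes are the down-sets of \<open>\<preceq>\<^sub>V\<close>. The subsets of an infinite antichain in
  \<open>C2 - C1\<close> generate, together with \<open>C1\<close>, pairwise distinct classes in the interval.
  Conversely, \<open>\<preceq>\<^sub>V\<close> is well-founded: the least arity of an operation equivalent to a given one
  strictly decreases along strict minors. So if \<open>C2 - C1\<close> has no infinite antichain, then for
  every \<open>K\<close> in the interval the up-set \<open>C2 - K\<close> has a finite basis, which determines \<open>K\<close>; and
  there are only countably many finite sets of operations.
\<close>

section \<open>Well-founded preorders\<close>

text \<open>Well-foundedness puts a minimal element of \<open>U\<close> below every element of
  \<open>U\<close>. One representative from each equivalence class of minimal elements gives an
  antichain, which is finite by \<open>fin\<close>.\<close>

lemma finite_basis_if_no_infinite_antichain: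
  fixes le :: "'b \<Rightarrow> 'b \<Rightarrow> bool"
  assumes refl: "\<And>x. le x x"
    and trans: "\<And>x y z. le x y \<Longrightarrow> le y z \<Longrightarrow> le x z"
    and wf: "wf {(x, y). le x y \<and> \<not> le y x}"
    and fin: "\<And>S. S \<subseteq> U \<Longrightarrow> pairwise (\<lambda>x y. \<not> le x y \<and> \<not> le y x) S \<Longrightarrow> finite S"
  shows "\<exists>B\<subseteq>U. finite B \<and> (\<forall>u\<in>U. \<exists>b\<in>B. le b u)"
proof -
  \<comment> \<open>Minimality in a preorder: anything in \<open>U\<close> below \<open>u\<close> is
    equivalent to \<open>u\<close>.\<close>
  define M where "M = {u\<in>U. \<forall>v\<in>U. le v u \<longrightarrow> le u v}"
  define r where "r u = (SOME v. v \<in> M \<and> le v u \<and> le u v)" for u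
  have r: "r u \<in> M" "le (r u) u" "le u (r u)" if "u \<in> M" for u
  proof -
    have "r u \<in> M \<and> le (r u) u \<and> le u (r u)"
      unfolding r_def by (rule someI[of _ u]) (use that refl in auto)
    then show "r u \<in> M" "le (r u) u" "le u (r u)" by auto
  qed
  have r_eq: "r u = r v" if "le u v" "le v u" for u v
  proof -
    \<comment> \<open>Equivalent elements yield the same choice predicate, so \<open>SOME\<close>
      returns literally the same representative.\<close>
    have "(\<lambda>w. w \<in> M \<and> le w u \<and> le u w) = (\<lambda>w. w \<in> M \<and> le w v \<and> le v w)"
      using that trans by blast
    then show ?thesis unfolding r_def by simp
  qed
  \<comment> \<open>Comparable representatives coincide: minimality of \<open>v\<close> turns
    \<open>le u v\<close> into an equivalence.\<close>
  have key: "r u = r v" if uv: "u \<in> M" "v \<in> M" and le: "le (r u) (r v)" for u v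
  proof -
    have "le u v" using r(3)[OF uv(1)] le r(2)[OF uv(2)] trans by blast
    moreover from this have "le v u" using uv by (auto simp: M_def)
    ultimately show ?thesis by (rule r_eq)
  qed
  show ?thesis
  proof (intro exI[of _ "r ` M"] conjI ballI)
    have "r ` M \<subseteq> M" using r by auto
    then show sub: "r ` M \<subseteq> U" by (auto simp: M_def)
    have "pairwise (\<lambda>x y. \<not> le x y \<and> \<not> le y x) (r ` M)"
      by (auto simp: pairwise_def dest: key)
    with sub show "finite (r ` M)" by (rule fin)
    show "\<exists>b\<in>r ` M. le b u" if u: "u \<in> U" for u
    proof -
      have "u \<in> {v\<in>U. le v u}" using u refl by auto
      from wfE_min[OF wf this] obtain z where z: "z \<in> U" "le z u"
        and min: "\<And>y. le y z \<and> \<not> le z y \<Longrightarrow> y \<notin> {v\<in>U. le v u}"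
        by auto
      have "z \<in> M" using z min trans by (auto simp: M_def)
      then show ?thesis using r(2) z(2) trans by blast
    qed
  qed
qed

section \<open>Minors\<close>

text \<open>Encodes a list of \<open>n\<close> projections of arity \<open>m\<close> by the index
  map \<sigma> that records which coordinate each one selects.\<close>

lemma projection_list_iff:
  "(length ps = n \<and> (\<forall>p\<in>set ps. p \<in> projections \<and> arity p = m)) \<longleftrightarrow>
   (\<exists>\<sigma>. (\<forall>i<n. \<sigma> i < m) \<and> ps = map (\<lambda>i. projection m (\<sigma> i)) [0..<n])"
    (is "?L \<longleftrightarrow> ?R")
proof
  assume L: ?L
  have "\<exists>k. k < m \<and> ps ! i = projection m k" if "i < n" for i
  proof -
    have "ps ! i \<in> projections" "arity (ps ! i) = m" using L that by auto
    then show ?thesis by (auto simp: projections_def projection_def arity_mk_operation)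
  qed
  then obtain \<sigma> where "\<And>i. i < n \<Longrightarrow> \<sigma> i < m \<and> ps ! i = projection m (\<sigma> i)" by metis
  with L show ?R by (auto intro!: exI[of _ \<sigma>] nth_equalityI)
next
  have "projection m k \<in> projections \<and> arity (projection m k) = m" if "k < m" for k
    using that by (auto simp: projections_def projection_def arity_mk_operation)
  moreover assume ?R
  ultimately show ?L by (metis (no_types, lifting) atLeastLessThan_iff diff_zero imageE length_map
    length_upt list.set_map set_upt)
qed

text \<open>The working form of the preorder: variable \<open>i\<close> of \<open>f\<close> is
  replaced by variable \<open>\<sigma> i\<close> of \<open>g\<close>, so \<sigma> may identify,
  permute or add inessential variables.\<close>

lemma minor_le_iff:
  "g \<preceq>\<^sub>V f \<longleftrightarrow> (\<exists>\<sigma>. (\<forall>i<arity f. \<sigma> i < arity g) \<and>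
     (\<forall>xs. length xs = arity g \<longrightarrow> app g xs = app f (map (\<lambda>i. xs ! \<sigma> i) [0..<arity f])))"
proof -
  have *: "g = superpose (arity g) f (map (\<lambda>i. projection (arity g) (\<sigma> i)) [0..<arity f]) \<longleftrightarrow>
    (\<forall>xs. length xs = arity g \<longrightarrow> app g xs = app f (map (\<lambda>i. xs ! \<sigma> i) [0..<arity f]))"
    (is "g = ?h \<longleftrightarrow> _") for \<sigma> :: "nat \<Rightarrow> nat"
  proof -
    have "app ?h xs = app f (map (\<lambda>i. xs ! \<sigma> i) [0..<arity f])" if "length xs = arity g" for xs
      using that arity_ge_1[of g]
      by (simp add: superpose_def app_mk_operation projection_def o_def)
    moreover have "arity ?h = arity g"
      using arity_ge_1[of g] by (simp add: superpose_def arity_mk_operation)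
    ultimately show ?thesis by (metis operation_eqI)
  qed
  have "g \<preceq>\<^sub>V f \<longleftrightarrow> (\<exists>ps. (\<exists>\<sigma>. (\<forall>i<arity f. \<sigma> i < arity g) \<and>
      ps = map (\<lambda>i. projection (arity g) (\<sigma> i)) [0..<arity f]) \<and> g = superpose (arity g) f ps)"
    unfolding minor_le_def projection_list_iff[symmetric] by blast
  also have "\<dots> \<longleftrightarrow> (\<exists>\<sigma>. (\<forall>i<arity f. \<sigma> i < arity g) \<and>
      g = superpose (arity g) f (map (\<lambda>i. projection (arity g) (\<sigma> i)) [0..<arity f]))"
    by blast
  finally show ?thesis unfolding * .
qed

lemma minor_leI:
  assumes "\<And>i. i < arity f \<Longrightarrow> \<sigma> i < arity g"
    and "\<And>xs. length xs = arity g \<Longrightarrow> app g xs = app f (map (\<lambda>i. xs ! \<sigma> i) [0..<arity f])"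
  shows "g \<preceq>\<^sub>V f"
  using assms unfolding minor_le_iff by blast

lemma minor_leE:
  assumes "g \<preceq>\<^sub>V f"
  obtains \<sigma> where "\<And>i. i < arity f \<Longrightarrow> \<sigma> i < arity g"
    and "\<And>xs. length xs = arity g \<Longrightarrow> app g xs = app f (map (\<lambda>i. xs ! \<sigma> i) [0..<arity f])"
  using assms unfolding minor_le_iff by blast

lemma minor_le_refl: "f \<preceq>\<^sub>V f"
  by (rule minor_leI[of _ id]) (auto intro!: arg_cong[where f = "app f"] nth_equalityI)

lemma minor_le_trans:
  assumes "h \<preceq>\<^sub>V g" "g \<preceq>\<^sub>V f"
  shows "h \<preceq>\<^sub>V f"
proof -
  obtain \<sigma> where \<sigma>: "\<And>i. i < arity g \<Longrightarrow> \<sigma> i < arity h"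
    "\<And>xs. length xs = arity h \<Longrightarrow> app h xs = app g (map (\<lambda>i. xs ! \<sigma> i) [0..<arity g])"
    using minor_leE[OF assms(1)] by blast
  obtain \<tau> where \<tau>: "\<And>i. i < arity f \<Longrightarrow> \<tau> i < arity g"
    "\<And>xs. length xs = arity g \<Longrightarrow> app g xs = app f (map (\<lambda>i. xs ! \<tau> i) [0..<arity f])"
    using minor_leE[OF assms(2)] by blast
  show ?thesis
  proof (rule minor_leI)
    \<comment> \<open>Successive substitutions of variables compose.\<close>
    show "(\<sigma> \<circ> \<tau>) i < arity h" if "i < arity f" for i
      using that \<sigma>(1) \<tau>(1) by simp
    show "app h xs = app f (map (\<lambda>i. xs ! (\<sigma> \<circ> \<tau>) i) [0..<arity f])"
      if "length xs = arity h" for xs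
    proof -
      have "app h xs =
          app f (map (\<lambda>i. map (\<lambda>i. xs ! \<sigma> i) [0..<arity g] ! \<tau> i) [0..<arity f])"
        using that by (simp only: \<sigma>(2) \<tau>(2) length_map length_upt diff_zero)
      also have "\<dots> = app f (map (\<lambda>i. xs ! (\<sigma> \<circ> \<tau>) i) [0..<arity f])"
        using \<tau>(1) by (intro arg_cong[where f = "app f"] map_cong) auto
      finally show ?thesis .
    qed
  qed
qed

section \<open>Essential rank and well-foundedness of the minor preorder\<close>

text \<open>This is the number of essential variables, except that constants get 1 because arities
  start at 1.\<close>

definition essential_rank :: "'a operation \<Rightarrow> nat" where
  "essential_rank f = (LEAST n. \<exists>f'. f' \<preceq>\<^sub>V f \<and> f \<preceq>\<^sub>V f' \<and> arity f' = n)"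

lemma essential_rank_le: "f' \<preceq>\<^sub>V f \<Longrightarrow> f \<preceq>\<^sub>V f' \<Longrightarrow> essential_rank f \<le> arity f'"
  unfolding essential_rank_def by (rule Least_le) blast

lemma essential_rank_attained:
  obtains f' where "f' \<preceq>\<^sub>V f" "f \<preceq>\<^sub>V f'" "arity f' = essential_rank f"
proof -
  have "\<exists>f'. f' \<preceq>\<^sub>V f \<and> f \<preceq>\<^sub>V f' \<and> arity f' = essential_rank f"
    unfolding essential_rank_def
    by (rule LeastI_ex[of "\<lambda>n. \<exists>f'. f' \<preceq>\<^sub>V f \<and> f \<preceq>\<^sub>V f' \<and> arity f' = n"])
      (use minor_le_refl in blast)
  then show thesis using that by blast
qed

text \<open>The operation \<open>g\<close> reads only the variables in the image of \<sigma>;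
  deleting the others leaves an equivalent operation.\<close>

lemma essential_rank_le_card_image:
  assumes \<sigma>: "\<And>i. i < arity f \<Longrightarrow> \<sigma> i < arity g"
    and g: "\<And>xs. length xs = arity g \<Longrightarrow> app g xs = app f (map (\<lambda>i. xs ! \<sigma> i) [0..<arity f])"
  shows "essential_rank g \<le> card (\<sigma> ` {..<arity f})"
proof -
  let ?I = "\<sigma> ` {..<arity f}"
  let ?k = "card ?I"
  have "?I \<noteq> {}" using arity_ge_1[of f] by (auto simp: lessThan_empty_iff)
  then have k: "1 \<le> ?k" by (simp add: Suc_le_eq card_gt_0_iff)
  obtain h where h: "bij_betw h {..<?k} ?I"
    using ex_bij_betw_nat_finite[of ?I] by (auto simp: atLeast0LessThan)
  \<comment> \<open>A left inverse of \<open>h\<close>, extended to all indices; the default 0 is a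
    legal index because \<open>1 \<le> ?k\<close>.\<close>
  define h' where "h' j = (if j \<in> ?I then inv_into {..<?k} h j else 0)" for j
  have h'_lt: "h' j < ?k" for j
    using inv_into_into[of j h "{..<?k}"] h k by (auto simp: h'_def bij_betw_def)
  have h_h': "h (h' (\<sigma> i)) = \<sigma> i" if "i < arity f" for i
    using that h by (auto simp: h'_def bij_betw_def f_inv_into_f)
  have h_lt: "h j < arity g" if "j < ?k" for j
  proof -
    have "h j \<in> ?I" using h that by (auto intro: bij_betw_apply)
    then show ?thesis using \<sigma> by auto
  qed
  \<comment> \<open>This is \<open>g\<close> with its inessential variables outside
    \<open>?I\<close> dropped and the rest renumbered; \<open>h\<close> and \<open>h'\<close> are
    the index maps for the two directions of equivalence.\<close>
  define g' where "g' = mk_operation ?k (\<lambda>ys. app f (map (\<lambda>i. ys ! h' (\<sigma> i)) [0..<arity f]))"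
  have ar: "arity g' = ?k" using k by (simp add: g'_def arity_mk_operation)
  have ap: "app g' ys = app f (map (\<lambda>i. ys ! h' (\<sigma> i)) [0..<arity f])" if "length ys = ?k" for ys
    using k that by (simp add: g'_def app_mk_operation)
  have "g \<preceq>\<^sub>V g'"
    by (rule minor_leI[of _ h])
      (auto simp: ar ap g h_lt h'_lt h_h' intro!: arg_cong[where f = "app f"])
  moreover have "g' \<preceq>\<^sub>V g"
    by (rule minor_leI[of _ h'])
      (auto simp: ar ap g \<sigma> h'_lt intro!: arg_cong[where f = "app f"])
  ultimately show ?thesis using essential_rank_le ar by metis
qed

text \<open>When no variables are identified, substituting along a left inverse of \<sigma> recovers
  \<open>f\<close>.\<close>

lemma minor_le_converse_if_inj:
  assumes \<sigma>: "\<And>i. i < arity f \<Longrightarrow> \<sigma> i < arity g"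
    and g: "\<And>xs. length xs = arity g \<Longrightarrow> app g xs = app f (map (\<lambda>i. xs ! \<sigma> i) [0..<arity f])"
    and inj: "inj_on \<sigma> {..<arity f}"
  shows "f \<preceq>\<^sub>V g"
proof -
  \<comment> \<open>Variables of \<open>g\<close> outside the image of \<sigma> do not affect its
    value, so they may all be sent to 0.\<close>
  define \<tau> where "\<tau> j = (if j \<in> \<sigma> ` {..<arity f} then inv_into {..<arity f} \<sigma> j else 0)" for j
  have \<tau>_lt: "\<tau> j < arity f" for j
    using inv_into_into[of j \<sigma> "{..<arity f}"] arity_ge_1[of f] by (auto simp: \<tau>_def)
  have \<tau>_\<sigma>: "\<tau> (\<sigma> i) = i" if "i < arity f" for i
    using that inj by (auto simp: \<tau>_def inv_into_f_f)
  show ?thesis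
    by (rule minor_leI[of _ \<tau>])
      (auto simp: \<tau>_lt g \<sigma> \<tau>_\<sigma> intro!: arg_cong[where f = "app f"] nth_equalityI)
qed

text \<open>Replace \<open>f\<close> by an equivalent \<open>f'\<close> of least arity. A strict
  minor must identify two variables of \<open>f'\<close>, so the image of \<sigma> has fewer than
  \<open>arity f'\<close> elements.\<close>

lemma essential_rank_less:
  assumes "g \<preceq>\<^sub>V f" "\<not> f \<preceq>\<^sub>V g"
  shows "essential_rank g < essential_rank f"
proof -
  obtain f' where f': "f' \<preceq>\<^sub>V f" "f \<preceq>\<^sub>V f'" "arity f' = essential_rank f"
    by (rule essential_rank_attained)
  have "g \<preceq>\<^sub>V f'" and not_le: "\<not> f' \<preceq>\<^sub>V g"
    using assms f' minor_le_trans by blast+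
  then obtain \<sigma> where \<sigma>: "\<And>i. i < arity f' \<Longrightarrow> \<sigma> i < arity g"
    "\<And>xs. length xs = arity g \<Longrightarrow> app g xs = app f' (map (\<lambda>i. xs ! \<sigma> i) [0..<arity f'])"
    using minor_leE by blast
  then have "\<not> inj_on \<sigma> {..<arity f'}" using minor_le_converse_if_inj not_le by blast
  then have "card (\<sigma> ` {..<arity f'}) < arity f'"
    using card_image_le[of "{..<arity f'}" \<sigma>] eq_card_imp_inj_on[of "{..<arity f'}" \<sigma>]
    by (auto simp: le_less)
  moreover have "essential_rank g \<le> card (\<sigma> ` {..<arity f'})"
    using \<sigma> by (rule essential_rank_le_card_image)
  ultimately show ?thesis using f'(3) by simp
qed

lemma wf_strict_minor: "wf {(g, f). g \<preceq>\<^sub>V f \<and> \<not> f \<preceq>\<^sub>V g}"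
  by (rule wf_subset[OF wf_measure[of essential_rank]]) (auto intro: essential_rank_less)

section \<open>Equational classes\<close>

lemma class_comp_projections: "class_comp K projections = {g. \<exists>f\<in>K. g \<preceq>\<^sub>V f}"
proof -
  have "arity (superpose m f gs) = m" if "1 \<le> m" for m and f :: "'a operation" and gs
    using that by (simp add: superpose_def arity_mk_operation)
  then show ?thesis
    unfolding class_comp_def minor_le_def using arity_ge_1 by fastforce
qed

text \<open>By reflexivity composing with projections never loses members of \<open>K\<close>, so
  being a fixed point amounts to being a down-set.\<close>

lemma equational_classes_iff:
  "K \<in> equational_classes \<longleftrightarrow> (\<forall>f\<in>K. \<forall>g. g \<preceq>\<^sub>V f \<longrightarrow> g \<in> K)"
  unfolding equational_classes_def class_comp_projections using minor_le_refl by blast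

section \<open>Cardinality of the interval\<close>

lemma countable_operations: "countable (UNIV :: 'a::finite operation set)"
proof -
  \<comment> \<open>For fixed arity, \<open>app\<close> embeds the operations into the finitely many
    extensional functions on tuples of that length.\<close>
  have fin: "finite {f :: 'a operation. arity f = n}" for n
  proof -
    have "finite ({xs :: 'a list. length xs = n} \<rightarrow>\<^sub>E (UNIV :: 'a set))"
      using finite_lists_length_eq[of "UNIV :: 'a set" n] by (intro finite_PiE) auto
    moreover have "app ` {f :: 'a operation. arity f = n} \<subseteq> {xs. length xs = n} \<rightarrow>\<^sub>E UNIV"
    proof
      fix F assume "F \<in> app ` {f :: 'a operation. arity f = n}"
      then obtain f where "F = app f" "arity f = n" by auto
      then show "F \<in> {xs. length xs = n} \<rightarrow>\<^sub>E UNIV"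
        using rep_operation[of f] by (auto simp: arity_def app_def PiE_def)
    qed
    moreover have "inj_on app {f :: 'a operation. arity f = n}"
      by (auto intro!: inj_onI operation_eqI)
    ultimately show ?thesis by (meson finite_imageD finite_subset)
  qed
  have "(UNIV :: 'a operation set) = (\<Union>n. {f. arity f = n})" by auto
  also have "countable \<dots>" using fin by (auto intro: countable_finite)
  finally show ?thesis .
qed

lemma countable_iff_lepoll: "countable A \<longleftrightarrow> A \<lesssim> (UNIV :: nat set)"
  by (simp add: countable_def lepoll_def)

lemma lepoll_Pow_Pow: "A \<lesssim> B \<Longrightarrow> Pow A \<lesssim> Pow B"
  unfolding lepoll_def by (meson image_Pow_mono inj_on_image_Pow)

lemma class_interval_lepoll:
  "class_interval C1 (C2 :: 'a::finite operation set) \<lesssim> (UNIV :: nat set set)"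
proof -
  have "(UNIV :: 'a operation set) \<lesssim> (UNIV :: nat set)"
    using countable_operations by (simp add: countable_iff_lepoll)
  then have "Pow (UNIV :: 'a operation set) \<lesssim> Pow (UNIV :: nat set)"
    by (rule lepoll_Pow_Pow)
  then show ?thesis
    by (metis Pow_UNIV lepoll_trans subset_UNIV subset_imp_lepoll)
qed

text \<open>Each subset \<open>T\<close> of \<open>S\<close> generates a class over
  \<open>C1\<close>, and \<open>T\<close> is recovered from that class by intersecting with
  \<open>S\<close>.\<close>

lemma lepoll_class_interval_if_antichain:
  assumes C: "C1 \<in> equational_classes" "C2 \<in> equational_classes" "C1 \<subseteq> C2"
    and S: "S \<subseteq> C2 - C1" "antichain S"
  shows "Pow S \<lesssim> class_interval C1 C2"
proof -
  define K where "K T = C1 \<union> {g. \<exists>f\<in>T. g \<preceq>\<^sub>V f}" for T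
  have "K T \<in> class_interval C1 C2" if "T \<subseteq> S" for T
  proof -
    have "K T \<in> equational_classes"
      using C(1) minor_le_trans unfolding equational_classes_iff K_def by blast
    moreover have "K T \<subseteq> C2"
      using C S that unfolding equational_classes_iff K_def by blast
    ultimately show ?thesis by (auto simp: class_interval_def K_def)
  qed
  moreover have "K T \<inter> S = T" if "T \<subseteq> S" for T
  proof
    show "K T \<inter> S \<subseteq> T"
    proof
      fix g assume "g \<in> K T \<inter> S"
      \<comment> \<open>Members of \<open>S\<close> avoid \<open>C1\<close>, so \<open>g\<close>
        must come from the down-set of \<open>T\<close>; the antichain property then forces
        \<open>g = f\<close>.\<close>
      then obtain f where f: "f \<in> T" "g \<preceq>\<^sub>V f" and g: "g \<in> S"
        using S(1) by (auto simp: K_def)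
      then have "g = f" using S(2) that pairwiseD[of _ S g f] by (auto simp: antichain_def)
      with f show "g \<in> T" by simp
    qed
    show "T \<subseteq> K T \<inter> S" using that minor_le_refl by (auto simp: K_def)
  qed
  then have "inj_on K (Pow S)" by (metis PowD inj_onI)
  ultimately show ?thesis unfolding lepoll_def by blast
qed

lemma countable_class_interval_if_no_infinite_antichain:
  fixes C1 C2 :: "'a::finite operation set"
  assumes no: "\<And>S. S \<subseteq> C2 - C1 \<Longrightarrow> antichain S \<Longrightarrow> finite S"
  shows "countable (class_interval C1 C2)"
proof -
  \<comment> \<open>The part of \<open>C2\<close> left after removing the up-set generated by
    \<open>B\<close>.\<close>
  define K where "K B = {f\<in>C2. \<forall>b\<in>B. \<not> b \<preceq>\<^sub>V f}" for B
  have "class_interval C1 C2 \<subseteq> K ` {B. finite B}"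
  proof
    fix L assume "L \<in> class_interval C1 C2"
    then have L: "\<And>f g. f \<in> L \<Longrightarrow> g \<preceq>\<^sub>V f \<Longrightarrow> g \<in> L" "C1 \<subseteq> L" "L \<subseteq> C2"
      by (auto simp: class_interval_def equational_classes_iff)
    \<comment> \<open>Since \<open>C1 \<subseteq> L\<close>, an antichain in \<open>C2 - L\<close>
      also lies in \<open>C2 - C1\<close>.\<close>
    have fin: "finite S"
      if "S \<subseteq> C2 - L" "pairwise (\<lambda>f g. \<not> f \<preceq>\<^sub>V g \<and> \<not> g \<preceq>\<^sub>V f) S" for S
      using no[of S] that L(2) by (auto simp: antichain_def)
    have "\<exists>B\<subseteq>C2 - L. finite B \<and> (\<forall>u\<in>C2 - L. \<exists>b\<in>B. b \<preceq>\<^sub>V u)"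
    proof (rule finite_basis_if_no_infinite_antichain)
      show "f \<preceq>\<^sub>V f" for f :: "'a operation" by (rule minor_le_refl)
      show "h \<preceq>\<^sub>V f" if "h \<preceq>\<^sub>V g" "g \<preceq>\<^sub>V f" for f g h :: "'a operation"
        using that by (rule minor_le_trans)
    qed (fact wf_strict_minor fin)+
    then obtain B where B: "finite B" "B \<subseteq> C2 - L" "\<forall>u\<in>C2 - L. \<exists>b\<in>B. b \<preceq>\<^sub>V u"
      by auto
    have "L = K B"
    proof
      show "L \<subseteq> K B"
      proof
        fix f assume "f \<in> L"
        \<comment> \<open>A basis element below \<open>f\<close> would be drawn into the down-set
          \<open>L\<close>, but \<open>B\<close> avoids \<open>L\<close>.\<close>
        then have "\<not> b \<preceq>\<^sub>V f" if "b \<in> B" for b using that L(1)[of f b] B(2) by auto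
        with \<open>f \<in> L\<close> L(3) show "f \<in> K B" by (auto simp: K_def)
      qed
      show "K B \<subseteq> L" using B(3) by (auto simp: K_def)
    qed
    with B(1) show "L \<in> K ` {B. finite B}" by blast
  qed
  moreover have "countable {B :: 'a operation set. finite B}"
    using countable_Collect_finite_subset[OF countable_operations] by simp
  ultimately show ?thesis by (meson countable_image countable_subset)
qed

lemma uncountable_nat_sets: "uncountable (UNIV :: nat set set)"
proof
  assume "countable (UNIV :: nat set set)"
  then have "(UNIV :: nat set set) \<lesssim> (UNIV :: nat set)" by (simp add: countable_iff_lepoll)
  then show False using lesspoll_Pow_self[of "UNIV :: nat set"]
    by (auto simp: lesspoll_def dest: lepoll_antisym)
qed

theorem theorem5:
  fixes C1 C2 :: "('a::finite) operation set"
  assumes "CARD('a) \<ge> 2"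
    and "C1 \<in> equational_classes" and "C2 \<in> equational_classes"
    and "idempotent_class C1" and "idempotent_class C2"
    and "C1 \<subseteq> C2"
  shows "(uncountable (class_interval C1 C2) \<longleftrightarrow>
            (\<exists>S \<subseteq> C2 - C1. infinite S \<and> antichain S)) \<and>
         (class_interval C1 C2 \<approx> (UNIV :: nat set set) \<longleftrightarrow>
            (\<exists>S \<subseteq> C2 - C1. infinite S \<and> antichain S))"
proof -
  have "class_interval C1 C2 \<approx> (UNIV :: nat set set)"
    if S: "S \<subseteq> C2 - C1" "infinite S" "antichain S" for S
  proof -
    \<comment> \<open>The infinite antichain has at least continuum many subsets, giving the lower
      bound; countability of the set of operations gives the upper one.\<close>
    have "(UNIV :: nat set) \<lesssim> S" using S(2) by (simp add: infinite_le_lepoll)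
    then have "Pow (UNIV :: nat set) \<lesssim> Pow S" by (rule lepoll_Pow_Pow)
    also have "Pow S \<lesssim> class_interval C1 C2"
      using assms(2,3,6) S(1,3) by (rule lepoll_class_interval_if_antichain)
    finally show ?thesis using class_interval_lepoll[of C1 C2] by (simp add: lepoll_antisym)
  qed
  moreover have "uncountable (class_interval C1 C2)"
    if "class_interval C1 C2 \<approx> (UNIV :: nat set set)"
    using that uncountable_nat_sets
    by (metis countable_lepoll eqpoll_imp_lepoll eqpoll_sym)
  \<comment> \<open>Closes the cycle: infinite antichain, size of the continuum, uncountable, and
    back by contraposition of the countability lemma.\<close>
  ultimately show ?thesis using countable_class_interval_if_no_infinite_antichain by metis
qed

end
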